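(* Let $b:\mathbb N\to\mathbb R$ be a real sequence which is not bounded from above and satisfies $\mathcal H(b)<+\infty$. Then $\mathcal H(b)\in\mathbb Z_+$. Besides, if we set $p=\mathcal H(b)-1$, then $p\in\mathbb N$ and there exists a sequence $s:\mathbb N\to\mathbb R$ with $s(n)\ge b(n)$ for every $n\in\mathbb N$, such that $s(0)\ge 0$ and $\Delta^p s$ is concave and not bounded from above (which implies that $s(n)>0$ for every $n\in\mathbb Z_+$, $s$ is strictly increasing, $\lim_{n\to+\infty}\frac{s(n)}{n^p}=+\infty$, $\bigl(\frac{s(n)}{n^{p+1}}\bigr)_{n\in\mathbb Z_+}$ is bounded, $\lim_{n\to+\infty}\frac{s(n+1)}{s(n)}=1$, $\Delta^{p+2}s\in\ell_1$, and moreover $s$ is convex if $p\in\mathbb Z_+$), and moreover $$\limsup_{n\to+\infty}\frac{b(n)}{s(n)}\in\Bigl[\frac1{p+1},1\Bigr]=\Bigl[\frac1{\mathcal H(b)},1\Bigr].$$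
   Context: $\mathbb N$ is the set of nonnegative integers and $\mathbb Z_+$ the set of strictly positive integers. For a real sequence $a:\mathbb N\to\mathbb R$, $\mathcal H(a)=\inf\{m\in\mathbb N:\ (a(n)/n^m)_{n\in\mathbb Z_+}\text{ is bounded from above}\}\in\mathbb N\cup\{+\infty\}$ (with $\inf\emptyset=+\infty$). The linear operator $\Delta$ on real sequences indexed by $\mathbb N$ is defined by $(\Delta a)(0)=a(0)$ and $(\Delta a)(n)=a(n)-a(n-1)$ for $n\in\mathbb Z_+$; $\Delta^p$ is its $p$-th iterate ($\Delta^0$ is the identity). A real sequence $a:\mathbb N\to\mathbb R$ is concave (convex) if the sequence $(a(n+1)-a(n))_{n\in\mathbb N}$ is nonincreasing (nondecreasing). $\ell_1$ is the space of absolutely summable sequences indexed by $\mathbb N$. *)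

theory Defs
  imports "HOL-Analysis.Analysis"
begin

text \<open>Values in \<^typ>\<open>enat\<close>; the infimum of the empty set is \<open>\<infinity>\<close> there.\<close>

definition growth_order :: "(nat \<Rightarrow> real) \<Rightarrow> enat" where
  "growth_order a = Inf (enat ` {m. bdd_above ((\<lambda>n. a n / real n ^ m) ` {1..})})"

definition bdiff :: "(nat \<Rightarrow> real) \<Rightarrow> nat \<Rightarrow> real" where
  "bdiff a n = (if n = 0 then a 0 else a n - a (n - 1))"

definition concave_seq :: "(nat \<Rightarrow> real) \<Rightarrow> bool" where
  "concave_seq a \<longleftrightarrow> decseq (\<lambda>n. a (n + 1) - a n)"

definition convex_seq :: "(nat \<Rightarrow> real) \<Rightarrow> bool" where
  "convex_seq a \<longleftrightarrow> incseq (\<lambda>n. a (n + 1) - a n)"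

end

theory Submission
  imports Defs
begin

text \<open>
  Write \<open>\<Sigma>\<close> for the inverse of \<open>\<Delta>\<close> (partial sums) and \<open>w n = (n + p choose p) = (\<Sigma>\<^sup>p 1) n\<close>.
  If \<open>c\<close> is concave and increasing with \<open>c 0 \<ge> 0\<close>, then \<open>(k / n) c n \<le> c k \<le> c n\<close> for \<open>k \<le> n\<close>, and
  since \<open>(\<Sigma>\<^sup>p id) n = n w n / (p + 1)\<close>, applying \<open>\<Sigma>\<^sup>p\<close> gives
  \<open>w n c n / (p + 1) \<le> (\<Sigma>\<^sup>p c) n \<le> w n c n\<close>. All properties of \<open>s = \<Sigma>\<^sup>p c\<close> follow from this.
  For the existence part take \<open>c\<close> to be the least concave majorant (with nonnegative affine
  majorants) of \<open>b / w\<close> and \<open>s = (p + 1) \<Sigma>\<^sup>p c\<close>. The upper limit of \<open>(b / w) / c\<close> is at least \<open>1\<close>: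
  if \<open>b / w \<le> \<theta> c\<close> eventually with \<open>\<theta> < 1\<close>, then every affine majorant can be scaled by \<open>\<theta>\<close> up
  to an additive constant \<open>K\<close>, so \<open>c \<le> \<theta> c + K\<close>, and \<open>c\<close> would be bounded.
\<close>

subsection \<open>Iterated partial sums\<close>

definition psum :: "(nat \<Rightarrow> real) \<Rightarrow> nat \<Rightarrow> real" where
  "psum a n = (\<Sum>k\<le>n. a k)"

lemma psum_0 [simp]: "psum a 0 = a 0"
  by (simp add: psum_def)

lemma psum_Suc [simp]: "psum a (Suc n) = psum a n + a (Suc n)"
  by (simp add: psum_def)

lemma psum_mono: "(\<And>k. k \<le> n \<Longrightarrow> f k \<le> g k) \<Longrightarrow> psum f n \<le> psum g n"
  by (auto simp: psum_def intro: sum_mono)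

lemma bdiff_0 [simp]: "bdiff a 0 = a 0"
  by (simp add: bdiff_def)

lemma bdiff_Suc [simp]: "bdiff a (Suc n) = a (Suc n) - a n"
  by (simp add: bdiff_def)

lemma bdiff_psum [simp]: "bdiff (psum a) = a"
proof
  show "bdiff (psum a) n = a n" for n
    by (cases n) simp_all
qed

lemma psum_bdiff [simp]: "psum (bdiff a) = a"
proof
  show "psum (bdiff a) n = a n" for n
    by (induction n) simp_all
qed

lemma bdiff_pow_psum_pow [simp]: "(bdiff ^^ p) ((psum ^^ p) a) = a"
proof (induction p arbitrary: a)
  case (Suc p)
  \<comment> \<open>One \<open>bdiff\<close> is split off on the inside and one \<open>psum\<close>
    on the outside, so that the two meet and cancel.\<close>
  have "(bdiff ^^ Suc p) ((psum ^^ Suc p) a) = (bdiff ^^ p) (bdiff (psum ((psum ^^ p) a)))"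
    by (simp only: funpow_Suc_right[of p bdiff] funpow.simps(2)[of p psum] comp_def)
  then show ?case
    using Suc by simp
qed simp

lemma psum_pow_bdiff_pow [simp]: "(psum ^^ p) ((bdiff ^^ p) a) = a"
proof (induction p arbitrary: a)
  case (Suc p)
  have "(psum ^^ Suc p) ((bdiff ^^ Suc p) a) = (psum ^^ p) (psum (bdiff ((bdiff ^^ p) a)))"
    by (simp only: funpow_Suc_right[of p psum] funpow.simps(2)[of p bdiff] comp_def)
  then show ?case
    using Suc by simp
qed simp

lemma bdiff_pow_zero [simp]: "(bdiff ^^ p) a 0 = a 0"
  by (induction p) simp_all

lemma psum_pow_zero [simp]: "(psum ^^ p) a 0 = a 0"
  by (induction p) simp_all

lemma psum_pow_mono:
  assumes "\<And>k. k \<le> n \<Longrightarrow> f k \<le> g k"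
  shows "(psum ^^ p) f n \<le> (psum ^^ p) g n"
  using assms
proof (induction p arbitrary: n)
  case (Suc p)
  have "(psum ^^ p) f k \<le> (psum ^^ p) g k" if "k \<le> n" for k
    using Suc that by simp
  then show ?case
    by (simp add: psum_mono)
qed simp

lemma psum_pow_cmult: "(psum ^^ p) (\<lambda>n. x * f n) = (\<lambda>n. x * (psum ^^ p) f n)"
  by (induction p) (simp_all add: psum_def sum_distrib_left fun_eq_iff)

section \<open>Binomial weights and their comparison with powers\<close>

lemma psum_pow_one: "(psum ^^ p) (\<lambda>_. 1) n = real (n + p choose p)"
proof (induction p arbitrary: n)
  case (Suc p)
  have "(psum ^^ Suc p) (\<lambda>_. 1) n = (\<Sum>k\<le>n. real (k + p choose p))"
    by (simp add: psum_def Suc)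
  also have "\<dots> = real (n + Suc p choose Suc p)"
    by (induction n) simp_all
  finally show ?case .
qed simp

text \<open>Repeated hockey-stick summation of the identity gives \<open>n + p choose Suc p\<close>.
  Absorption turns this into \<open>n / (p + 1)\<close> times the weight
  \<open>n + p choose p\<close>, which is the origin of the constant
  \<open>1 / (p + 1)\<close>.\<close>

lemma psum_pow_id: "(psum ^^ p) real n = real n / real (p + 1) * real (n + p choose p)"
proof -
  have "(psum ^^ p) real n = real (n + p choose Suc p)"
  proof (induction p arbitrary: n)
    case (Suc p)
    have "(psum ^^ Suc p) real n = (\<Sum>k\<le>n. real (k + p choose Suc p))"
      by (simp add: psum_def Suc)
    also have "\<dots> = real (n + Suc p choose Suc (Suc p))"
      by (induction n) simp_all
    finally show ?case .
  qed simp
  moreover have "Suc p * (n + p choose Suc p) = n * (n + p choose p)"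
    using binomial_absorb_comp[of "n + p" p] binomial_absorption[of p "n + p"] by simp
  then have "real (p + 1) * real (n + p choose Suc p) = real n * real (n + p choose p)"
    by (metis Suc_eq_plus1 of_nat_mult)
  ultimately show ?thesis
    by (simp add: field_simps)
qed

lemma binomial_le_pow_Suc: "real (n + p choose p) \<le> (real n + 1) ^ p"
proof (induction p arbitrary: n)
  case (Suc p)
  have "real (n + Suc p choose Suc p) = (\<Sum>k\<le>n. (psum ^^ p) (\<lambda>_. 1) k)"
    by (simp only: psum_pow_one[symmetric] funpow.simps comp_def psum_def)
  also have "\<dots> \<le> (\<Sum>k\<le>n. (real n + 1) ^ p)"
    unfolding psum_pow_one
    by (rule sum_mono) (auto intro!: order_trans[OF Suc] power_mono)
  also have "\<dots> = (real n + 1) ^ Suc p"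
    by simp
  finally show ?case .
qed simp

lemma pow_le_binomial: "real n ^ p \<le> real p ^ p * real (n + p choose p)"
\<comment> \<open>The argument divides by \<open>p\<close>; for \<open>p = 0\<close> the claim reads
  1 \<le> 1 because \<open>0 ^ 0 = 1\<close>.\<close>
proof (cases "p = 0")
  case False
  have "(real n / real p) ^ p \<le> (real (n + p) / real p) ^ p"
    by (intro power_mono divide_right_mono) auto
  also have "\<dots> \<le> real (n + p choose p)"
    using binomial_ge_n_over_k_pow_k[of p "n + p", where 'a = real] by simp
  finally show ?thesis
    using False by (simp add: power_divide field_simps)
qed simp

subsection \<open>Unbounded concave sequences\<close>

lemma concave_seq_Suc_diff_le:
  assumes "concave_seq c" "m \<le> n"
  shows "c (Suc n) - c n \<le> c (Suc m) - c m"
  using decseqD[OF assms(1)[unfolded concave_seq_def] assms(2)] by simp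

text \<open>After one nonpositive increment all later ones are nonpositive, so the values up to that
  index would bound the whole sequence.\<close>

lemma concave_seq_less_Suc:
  assumes "concave_seq c" "\<not> bdd_above (range c)"
  shows "c n < c (Suc n)"
proof (rule ccontr)
  assume *: "\<not> c n < c (Suc n)"
  have le: "c m \<le> c n" if "n \<le> m" for m
    using that
  proof (induction m rule: dec_induct)
    case (step m)
    then show ?case
      using concave_seq_Suc_diff_le[OF assms(1) step(1)] * by linarith
  qed simp
  have "range c \<subseteq> c ` {..n} \<union> {..c n}"
  proof (rule image_subsetI)
    show "c m \<in> c ` {..n} \<union> {..c n}" for m
      using le[of m] by (cases "n \<le> m") auto
  qed
  moreover have "bdd_above (c ` {..n} \<union> {..c n})"
    by (simp add: bdd_above_finite)
  ultimately show False
    using assms(2) bdd_above_mono by metis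
qed

text \<open>Since \<open>c 0\<close> is nonnegative, \<open>c n / n\<close> is nonincreasing.
  Clearing denominators covers \<open>k = 0\<close> as well.\<close>

lemma concave_seq_chord:
  assumes "concave_seq c" "c 0 \<ge> 0" "k \<le> n"
  shows "real k * c n \<le> real n * c k"
proof (cases "k = 0")
  case False
  have tangent: "real m * (c (Suc m) - c m) \<le> c m" for m
  proof -
    \<comment> \<open>The increment at \<open>m\<close> is at most each earlier one, and the earlier
      ones telescope to \<open>c m - c 0\<close>.\<close>
    have "real m * (c (Suc m) - c m) = (\<Sum>i<m. c (Suc m) - c m)"
      by simp
    also have "\<dots> \<le> (\<Sum>i<m. c (Suc i) - c i)"
      by (intro sum_mono concave_seq_Suc_diff_le[OF assms(1)]) auto
    also have "\<dots> \<le> c m"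
      using assms(2) by (simp add: sum_lessThan_telescope)
    finally show ?thesis .
  qed
  show ?thesis
    using assms(3)
  proof (induction n rule: dec_induct)
    case (step n)
    have "real n * (real k * c (Suc n)) = real k * (real n * (c (Suc n) - c n) + real n * c n)"
      by (simp add: algebra_simps)
    also have "\<dots> \<le> real k * (c n + real n * c n)"
      using tangent[of n] by (intro mult_left_mono) auto
    also have "\<dots> = real (Suc n) * (real k * c n)"
      by (simp add: algebra_simps)
    also have "\<dots> \<le> real (Suc n) * (real n * c k)"
      using step by (intro mult_left_mono) auto
    also have "\<dots> = real n * (real (Suc n) * c k)"
      by simp
    finally show ?case
      using False step(1) by (simp del: of_nat_Suc)
  qed simp
qed (use assms in simp)

text \<open>Up to index \<open>n\<close>, \<open>c\<close> lies above the line through the origin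
  with slope \<open>c n / n\<close>; \<open>psum_pow_id\<close> evaluates the iterated sum of that
  line.\<close>

lemma concave_seq_psum_pow_lower:
  assumes "concave_seq c" "c 0 \<ge> 0"
  shows "real (n + p choose p) * c n \<le> real (p + 1) * (psum ^^ p) c n"
proof (cases "n = 0")
  case True
  with assms(2) show ?thesis
    by (simp add: algebra_simps)
next
  case False
  have "(psum ^^ p) (\<lambda>k. c n / real n * real k) n \<le> (psum ^^ p) c n"
    using concave_seq_chord[OF assms] False
    by (intro psum_pow_mono) (simp add: field_simps)
  then show ?thesis
    unfolding psum_pow_cmult psum_pow_id using False by (simp add: field_simps)
qed

lemma mono_psum_pow_upper:
  assumes "mono c"
  shows "(psum ^^ p) c n \<le> real (n + p choose p) * c n"
proof -
  have "(psum ^^ p) c n \<le> (psum ^^ p) (\<lambda>_. c n * 1) n"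
    using assms by (intro psum_pow_mono) (simp add: monoD)
  also have "\<dots> = real (n + p choose p) * c n"
    unfolding psum_pow_cmult[of p "c n"] psum_pow_one by simp
  finally show ?thesis .
qed

text \<open>In the theorem \<open>c\<close> is \<open>(bdiff ^^ p) s\<close>, so that facts about
  \<open>(psum ^^ p) c\<close> become facts about \<open>s\<close>.\<close>

locale unbounded_concave =
  fixes c :: "nat \<Rightarrow> real"
  assumes concave: "concave_seq c" and unbounded: "\<not> bdd_above (range c)" and zero: "c 0 \<ge> 0"
begin

lemma less_Suc: "c n < c (Suc n)"
  by (rule concave_seq_less_Suc[OF concave unbounded])

lemma strict: "strict_mono c"
  using less_Suc by (simp add: strict_mono_Suc_iff)

lemma nonneg: "c n \<ge> 0"
  using zero strict_mono_less_eq[OF strict, of 0 n] by simp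

lemma at_top: "filterlim c at_top sequentially"
  unfolding filterlim_at_top eventually_sequentially
proof
  fix Z
  obtain N where "c N > Z"
    using unbounded by (auto simp: bdd_above_def not_le)
  then have "\<forall>n\<ge>N. Z \<le> c n"
    using strict_mono_less_eq[OF strict] by (meson less_imp_le order_trans)
  then show "\<exists>N. \<forall>n\<ge>N. Z \<le> c n" ..
qed

lemma le_linear: "c n \<le> c 1 * (real n + 1)"
proof (cases "n = 0")
  case True
  then show ?thesis using less_Suc[of 0] by simp
next
  case False
  then have "c n \<le> real n * c 1"
    using concave_seq_chord[OF concave zero, of 1 n] by simp
  then show ?thesis
    using nonneg[of 1] by (simp add: algebra_simps)
qed

lemma psum_pow_nonneg: "(psum ^^ p) c n \<ge> 0"
  \<comment> \<open>Writing zero as \<open>0 * 0\<close> lets \<open>psum_pow_cmult\<close> pull a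
    factor 0 out of the iterated sum.\<close>
  using psum_pow_mono[of n "\<lambda>_. 0 * 0" c p] nonneg by (simp only: psum_pow_cmult) simp

text \<open>The increments of a partial sum are the summands, and these are positive from index 1
  on: the previous iterate starts at \<open>c 0\<close>, which is nonnegative, and increases
  strictly.\<close>

lemma psum_pow_strict: "strict_mono ((psum ^^ p) c)"
proof (induction p)
  case (Suc p)
  have "(psum ^^ p) c (Suc n) > 0" for n
    using strict_monoD[OF Suc, of 0 "Suc n"] zero by simp
  then show ?case
    by (simp add: strict_mono_Suc_iff)
qed (simp add: strict)

lemma psum_pow_pos: "n \<ge> 1 \<Longrightarrow> (psum ^^ p) c n > 0"
  using strict_monoD[OF psum_pow_strict, of 0 n p] zero by simp

lemma psum_pow_convex:
  assumes "p \<ge> 1"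
  shows "convex_seq ((psum ^^ p) c)"
proof -
  obtain q where "p = Suc q"
    using assms by (cases p) auto
  then show ?thesis
    using strict_mono_less_eq[OF psum_pow_strict[of q]]
    by (auto simp: convex_seq_def intro!: incseq_SucI)
qed

lemma psum_pow_at_top: "filterlim (\<lambda>n. (psum ^^ p) c n / real n ^ p) at_top sequentially"
proof (rule filterlim_at_top_mono)
  \<comment> \<open>The product of the constants in \<open>pow_le_binomial\<close> and
    \<open>concave_seq_psum_pow_lower\<close>.\<close>
  let ?K = "real p ^ p * real (p + 1)"
  have K: "?K > 0"
    by (cases "p = 0") auto
  show "filterlim (\<lambda>n. c n / ?K) at_top sequentially"
    using filterlim_tendsto_pos_mult_at_top[OF tendsto_const[of "1 / ?K"] _ at_top] K by simp
  show "\<forall>\<^sub>F n in sequentially. c n / ?K \<le> (psum ^^ p) c n / real n ^ p"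
    using eventually_gt_at_top[of 0]
  proof eventually_elim
    case (elim n)
    have "real n ^ p * c n \<le> real p ^ p * real (n + p choose p) * c n"
      using pow_le_binomial nonneg by (rule mult_right_mono)
    also have "\<dots> = real p ^ p * (real (n + p choose p) * c n)"
      by simp
    also have "\<dots> \<le> real p ^ p * (real (p + 1) * (psum ^^ p) c n)"
      using concave_seq_psum_pow_lower[OF concave zero] by (rule mult_left_mono) simp
    finally show ?case
      using elim K by (simp add: field_simps)
  qed
qed

lemma psum_pow_le: "(psum ^^ p) c n \<le> c 1 * (real n + 1) ^ (p + 1)"
proof -
  have "(psum ^^ p) c n \<le> real (n + p choose p) * c n"
    using strict by (intro mono_psum_pow_upper strict_mono_mono)
  also have "\<dots> \<le> (real n + 1) ^ p * (c 1 * (real n + 1))"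
    using binomial_le_pow_Suc le_linear nonneg by (intro mult_mono) auto
  finally show ?thesis
    by (simp add: mult_ac)
qed

lemma psum_pow_bounded: "bounded ((\<lambda>n. (psum ^^ p) c n / real n ^ (p + 1)) ` {1..})"
proof -
  have "norm ((psum ^^ p) c n / real n ^ (p + 1)) \<le> c 1 * 2 ^ (p + 1)" if "n \<ge> 1" for n
  proof -
    have "(psum ^^ p) c n \<le> c 1 * (2 * real n) ^ (p + 1)"
      using that nonneg[of 1]
      by (intro order_trans[OF psum_pow_le] mult_left_mono power_mono) auto
    then show ?thesis
      using that psum_pow_nonneg[of p n]
      by (simp add: power_mult_distrib pos_divide_le_eq mult_ac)
  qed
  then show ?thesis
    by (auto simp: bounded_iff)
qed

lemma psum_pow_diff_le: "(psum ^^ p) c (Suc n) - (psum ^^ p) c n \<le> c 1 * (real n + 2) ^ p"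
proof (cases p)
  case 0
  then show ?thesis
    using concave_seq_Suc_diff_le[OF concave, of 0 n] zero by simp
next
  case (Suc q)
  then show ?thesis
    using psum_pow_le[of q "Suc n"] by (simp add: add_ac)
qed

text \<open>The ratio minus 1 is an increment of order at most \<open>n ^ p\<close> divided by a
  term that outgrows \<open>n ^ p\<close>.\<close>

lemma psum_pow_ratio: "(\<lambda>n. (psum ^^ p) c (n + 1) / (psum ^^ p) c n) \<longlonglongrightarrow> 1"
proof -
  let ?s = "(psum ^^ p) c"
  have lim: "(\<lambda>n. c 1 * 3 ^ p * inverse (?s n / real n ^ p)) \<longlonglongrightarrow> 0"
    by (intro tendsto_mult_right_zero tendsto_inverse_0_at_top psum_pow_at_top)
  have "(\<lambda>n. ?s (n + 1) / ?s n - 1) \<longlonglongrightarrow> 0"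
  proof (rule tendsto_sandwich[OF _ _ tendsto_const lim])
    show "\<forall>\<^sub>F n in sequentially. 0 \<le> ?s (n + 1) / ?s n - 1"
      using eventually_gt_at_top[of 0]
    proof eventually_elim
      case (elim n)
      then show ?case
        using psum_pow_pos[of n p] strict_monoD[OF psum_pow_strict, of n "n + 1" p]
        by (simp add: field_simps)
    qed
    show "\<forall>\<^sub>F n in sequentially. ?s (n + 1) / ?s n - 1 \<le> c 1 * 3 ^ p * inverse (?s n / real n ^ p)"
      using eventually_gt_at_top[of 0]
    proof eventually_elim
      case (elim n)
      have "?s (n + 1) - ?s n \<le> c 1 * (real n + 2) ^ p"
        using psum_pow_diff_le by simp
      also have "\<dots> \<le> c 1 * (3 * real n) ^ p"
        using elim nonneg[of 1] by (intro mult_left_mono power_mono) auto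
      finally have "(?s (n + 1) - ?s n) / ?s n \<le> c 1 * (3 * real n) ^ p / ?s n"
        using elim psum_pow_pos[of n p] by (intro divide_right_mono) auto
      then show ?case
        using elim psum_pow_pos[of n p] by (simp add: diff_divide_distrib power_mult_distrib)
    qed
  qed
  from tendsto_add[OF this tendsto_const[of 1]] show ?thesis
    by simp
qed

lemma summable_second_difference: "summable (\<lambda>n. \<bar>bdiff (bdiff c) n\<bar>)"
proof -
  let ?d = "\<lambda>n. c (Suc n) - c n"
  have "decseq ?d"
    using concave by (simp add: concave_seq_def)
  moreover have "\<forall>n. 0 \<le> ?d n"
    using less_Suc by (simp add: less_imp_le)
  ultimately obtain L where "?d \<longlonglongrightarrow> L"
    by (rule decseq_convergent)
  then have "summable (\<lambda>n. ?d n - ?d (Suc n))"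
    by (rule telescope_summable')
  \<comment> \<open>Only from index 2 on is \<open>bdiff (bdiff c)\<close> free of the boundary
    convention \<open>bdiff a 0 = a 0\<close>. There its absolute values are the terms of a
    telescoping series.\<close>
  moreover have "\<bar>bdiff (bdiff c) (n + 2)\<bar> = ?d n - ?d (Suc n)" for n
    using concave_seq_Suc_diff_le[OF concave, of n "Suc n"] by simp
  ultimately have "summable (\<lambda>n. \<bar>bdiff (bdiff c) (n + 2)\<bar>)"
    by simp
  then show ?thesis
    by (rule summable_iff_shift[THEN iffD1])
qed

end

subsection \<open>The concave majorant\<close>

text \<open>Affine functions satisfy the midpoint identity, so their infimum satisfies the midpoint
  inequality on three consecutive indices, which says that increments do not grow.\<close>

lemma INF_affine_concave:
  fixes A :: "(real \<times> real) set"
  assumes "A \<noteq> {}" and bdd: "\<And>n. bdd_below ((\<lambda>(u, v). u + v * real n) ` A)"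
  shows "concave_seq (\<lambda>n. INF (u, v)\<in>A. u + v * real n)"
  unfolding concave_seq_def
proof (rule decseq_SucI)
  fix n
  define c where "c n = (INF (u, v)\<in>A. u + v * real n)" for n
  have le: "c n \<le> u + v * real n" if "(u, v) \<in> A" for u v n
    unfolding c_def using cINF_lower[OF bdd that] by simp
  have "(c n + c (n + 2)) / 2 \<le> c (n + 1)"
    unfolding c_def[of "n + 1"]
  proof (rule cINF_greatest[OF assms(1)], clarify)
    fix u v assume "(u, v) \<in> A"
    from le[OF this, of n] le[OF this, of "n + 2"]
    show "(c n + c (n + 2)) / 2 \<le> u + v * real (n + 1)"
      by (simp add: field_simps)
  qed
  then show "c (Suc n + 1) - c (Suc n) \<le> c (n + 1) - c n"
    by simp
qed

lemma concave_majorant: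
  fixes \<beta> :: "nat \<Rightarrow> real"
  assumes unbdd: "\<not> bdd_above (range \<beta>)"
    and lin: "\<And>n. n \<ge> 1 \<Longrightarrow> \<beta> n \<le> C * real n"
  obtains c where "unbounded_concave c" "\<And>n. \<beta> n \<le> c n"
    "\<And>\<theta> N. \<theta> < 1 \<Longrightarrow> \<exists>n\<ge>N. \<theta> * c n < \<beta> n"
proof -
  \<comment> \<open>The sign conditions on \<open>u\<close> and \<open>v\<close> keep the infimum
    nonnegative, in particular \<open>c 0\<close>.\<close>
  define A where "A = {(u, v). u \<ge> 0 \<and> v \<ge> 0 \<and> (\<forall>n. \<beta> n \<le> u + v * real n)}"
  define c where "c n = (INF (u, v)\<in>A. u + v * real n)" for n
  have "\<beta> n \<le> max 0 (\<beta> 0) + max 0 C * real n" for n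
  proof (cases "n = 0")
    case False
    then have "\<beta> n \<le> C * real n"
      using lin by simp
    also have "\<dots> \<le> max 0 C * real n"
      by (intro mult_right_mono) auto
    finally show ?thesis by linarith
  qed simp
  then have "(max 0 (\<beta> 0), max 0 C) \<in> A"
    by (simp add: A_def)
  then have ne: "A \<noteq> {}"
    by blast
  have bdd: "bdd_below ((\<lambda>(u, v). u + v * real n) ` A)" for n
    by (rule bdd_belowI[of _ 0]) (auto simp: A_def)
  have le: "c n \<le> u + v * real n" if "(u, v) \<in> A" for u v n
    unfolding c_def using cINF_lower[OF bdd that] by simp
  have nonneg: "c n \<ge> 0" for n
    unfolding c_def by (rule cINF_greatest[OF ne]) (auto simp: A_def)
  have ge: "\<beta> n \<le> c n" for n
    unfolding c_def by (rule cINF_greatest[OF ne]) (auto simp: A_def)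
  have unbdd_c: "\<not> bdd_above (range c)"
    using unbdd ge by (auto simp: bdd_above_def) (meson order_trans)
  have "concave_seq c"
    using INF_affine_concave[OF ne bdd] unfolding c_def .
  with unbdd_c nonneg have "unbounded_concave c"
    by unfold_locales
  moreover have "\<exists>n\<ge>N. \<theta> * c n < \<beta> n" if "\<theta> < 1" for \<theta> N
  proof (rule ccontr)
    assume "\<not> (\<exists>n\<ge>N. \<theta> * c n < \<beta> n)"
    \<comment> \<open>A negative \<theta> is replaced by 0, so that scaling by \<tau> preserves the
      sign conditions in \<open>A\<close>.\<close>
    define \<tau> where "\<tau> = max 0 \<theta>"
    have \<tau>: "0 \<le> \<tau>" "\<tau> < 1"
      using that by (auto simp: \<tau>_def)
    have tail: "\<beta> n \<le> \<tau> * c n" if "n \<ge> N" for n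
    proof -
      have "\<beta> n \<le> \<theta> * c n"
        using \<open>\<not> (\<exists>n\<ge>N. \<theta> * c n < \<beta> n)\<close> that by (auto simp: not_less)
      also have "\<dots> \<le> \<tau> * c n"
        using nonneg by (intro mult_right_mono) (auto simp: \<tau>_def)
      finally show ?thesis .
    qed
    define K where "K = (\<Sum>n<N. \<bar>\<beta> n\<bar>)"
    have K: "K \<ge> 0"
      by (simp add: K_def sum_nonneg)
    have "(\<tau> * u + K, \<tau> * v) \<in> A" if uv: "(u, v) \<in> A" for u v
    proof -
      have nn: "u \<ge> 0" "v \<ge> 0"
        using uv by (auto simp: A_def)
      have "\<beta> n \<le> \<tau> * u + K + \<tau> * v * real n" for n
      proof (cases "n < N")
        case True
        then have "\<bar>\<beta> n\<bar> \<le> K"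
          unfolding K_def by (intro member_le_sum) auto
        moreover have "\<tau> * u \<ge> 0" "\<tau> * v * real n \<ge> 0"
          using \<tau> nn by auto
        ultimately show ?thesis by linarith
      next
        case False
        then have "\<beta> n \<le> \<tau> * c n"
          using tail by simp
        also have "\<dots> \<le> \<tau> * (u + v * real n)"
          using le[OF uv] \<tau> by (intro mult_left_mono) auto
        finally show ?thesis
          using K by (simp add: algebra_simps)
      qed
      then show ?thesis
        using nn \<tau> K by (simp add: A_def)
    qed
    from le[OF this] have step: "c n - K \<le> \<tau> * (u + v * real n)" if "(u, v) \<in> A" for u v n
      using that by (fastforce simp: algebra_simps)
    \<comment> \<open>The infimum over \<open>A\<close> in \<open>step\<close> gives
      \<open>c n - K \<le> \<tau> * c n\<close>. It is taken after dividing by \<tau>, hence the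
      separate case \<tau> = 0.\<close>
    have "c n \<le> K / (1 - \<tau>)" for n
    proof (cases "\<tau> = 0")
      case True
      with ne step show ?thesis by fastforce
    next
      case False
      have "(c n - K) / \<tau> \<le> c n"
        unfolding c_def[of n]
        using step[of _ _ n] \<tau> False
        by (intro cINF_greatest[OF ne]) (auto simp: c_def[symmetric] pos_divide_le_eq mult_ac)
      then show ?thesis
        using \<tau> False by (simp add: field_simps)
    qed
    then show False
      using unbdd_c by (auto simp: bdd_above_def)
  qed
  ultimately show ?thesis
    using ge that by blast
qed

subsection \<open>The growth order\<close>

text \<open>A finite infimum of natural numbers is attained. Exponent 0 is impossible, since with
  the single value \<open>b 0\<close> added it would bound \<open>b\<close>; minimality excludes the
  exponent \<open>p\<close>.\<close>

lemma growth_order_eq_SucE: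
  assumes "\<not> bdd_above (range b)" "growth_order b < \<infinity>"
  obtains p where "growth_order b = enat (p + 1)"
    "bdd_above ((\<lambda>n. b n / real n ^ (p + 1)) ` {1..})"
    "\<not> bdd_above ((\<lambda>n. b n / real n ^ p) ` {1..})"
proof -
  define S where "S = {m. bdd_above ((\<lambda>n. b n / real n ^ m) ` {1..})}"
  have go: "growth_order b = Inf (enat ` S)"
    by (simp add: growth_order_def S_def)
  have "S \<noteq> {}"
    using assms(2) unfolding go by (auto simp: Inf_enat_def)
  then have "enat ` S \<noteq> {}"
    by simp
  then have "Inf (enat ` S) \<in> enat ` S"
    unfolding Inf_enat_def by (auto intro: LeastI)
  then obtain m where m: "m \<in> S" "growth_order b = enat m"
    unfolding go by auto
  have least: "m \<le> k" if "k \<in> S" for k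
    using that m(2) Inf_lower[of "enat k" "enat ` S"] unfolding go by simp
  have "0 \<notin> S"
  proof
    assume "0 \<in> S"
    then have "bdd_above (insert (b 0) (b ` {1..}))"
      by (simp add: S_def)
    moreover have "range b \<subseteq> insert (b 0) (b ` {1..})"
      by (auto simp: image_iff) (metis Suc_leI atLeast_iff gr0I)
    ultimately have "bdd_above (range b)"
      by (rule bdd_above_mono)
    with assms(1) show False ..
  qed
  with m(1) obtain p where "m = Suc p"
    by (cases m) auto
  moreover from this have "p \<notin> S"
    using least[of p] by auto
  ultimately show ?thesis
    using m that by (auto simp: S_def)
qed

section \<open>Construction of the majorant and its upper limit\<close>

lemma majorant_exists:
  assumes bdd: "bdd_above ((\<lambda>n. b n / real n ^ (p + 1)) ` {1..})"
    and unbdd: "\<not> bdd_above ((\<lambda>n. b n / real n ^ p) ` {1..})"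
  shows "\<exists>s :: nat \<Rightarrow> real. (\<forall>n. s n \<ge> b n) \<and> s 0 \<ge> 0 \<and> concave_seq ((bdiff ^^ p) s) \<and>
    \<not> bdd_above (range ((bdiff ^^ p) s)) \<and>
    limsup (\<lambda>n. ereal (b n / s n)) \<in> {ereal (1 / real (p + 1))..1}"
proof -
  \<comment> \<open>Unlike \<open>n ^ p\<close>, this weight is the iterated sum of the constant 1
    and is positive at 0 for every \<open>p\<close>; both have the same order of growth.\<close>
  define w where "w n = real (n + p choose p)" for n
  have w: "w n > 0" for n
    by (simp add: w_def)
  define \<beta> where "\<beta> n = b n / w n" for n
  have b_eq: "b n = w n * \<beta> n" for n
    using w[of n] by (simp add: \<beta>_def)
  obtain C where C: "b n / real n ^ (p + 1) \<le> C" if "n \<ge> 1" for n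
    using bdd by (auto simp: bdd_above_def)
  have "\<beta> n \<le> (max 0 C * real p ^ p) * real n" if "n \<ge> 1" for n
  proof -
    have "b n \<le> C * real n ^ (p + 1)"
      using C[OF that] that by (simp add: pos_divide_le_eq)
    also have "\<dots> \<le> max 0 C * real n ^ (p + 1)"
      by (intro mult_right_mono) auto
    also have "\<dots> = max 0 C * real n * real n ^ p"
      by simp
    also have "\<dots> \<le> max 0 C * real n * (real p ^ p * w n)"
      unfolding w_def by (intro mult_left_mono pow_le_binomial) auto
    finally show ?thesis
      using w[of n] by (simp add: \<beta>_def pos_divide_le_eq mult_ac)
  qed
  moreover have "\<not> bdd_above (range \<beta>)"
  proof
    assume "bdd_above (range \<beta>)"
    then obtain K where K: "\<beta> n \<le> K" for n
      by (auto simp: bdd_above_def)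
    have "b n / real n ^ p \<le> max 0 K * 2 ^ p" if "n \<ge> 1" for n
    proof -
      have "b n \<le> w n * max 0 K"
        unfolding b_eq using K[of n] w[of n] by (intro mult_left_mono) auto
      also have "\<dots> \<le> (2 * real n) ^ p * max 0 K"
        unfolding w_def using that
        by (intro mult_right_mono order_trans[OF binomial_le_pow_Suc] power_mono) auto
      finally show ?thesis
        using that by (simp add: pos_divide_le_eq power_mult_distrib mult_ac)
    qed
    then show False
      using unbdd by (auto simp: bdd_above_def)
  qed
  ultimately obtain c where c: "unbounded_concave c" "\<And>n. \<beta> n \<le> c n"
    "\<And>\<theta> N. \<theta> < 1 \<Longrightarrow> \<exists>n\<ge>N. \<theta> * c n < \<beta> n"
    using concave_majorant by metis
  interpret unbounded_concave c by (fact c(1))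
  \<comment> \<open>The factor \<open>p + 1\<close> makes up for the loss in
    \<open>concave_seq_psum_pow_lower\<close>, so that \<open>s\<close> dominates
    \<open>w n * c n\<close> and hence \<open>b\<close>.\<close>
  define s where "s = (psum ^^ p) (\<lambda>n. real (p + 1) * c n)"
  have s_eq: "s n = real (p + 1) * (psum ^^ p) c n" for n
    by (simp add: s_def psum_pow_cmult)
  have diff_s: "(bdiff ^^ p) s = (\<lambda>n. real (p + 1) * c n)"
    by (simp add: s_def)
  have s_ge: "b n \<le> s n" for n
  proof -
    have "b n \<le> w n * c n"
      unfolding b_eq using c(2)[of n] w[of n] by (intro mult_left_mono) auto
    also have "\<dots> \<le> s n"
      unfolding w_def s_eq by (rule concave_seq_psum_pow_lower[OF concave zero])
    finally show ?thesis .
  qed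
  have s_pos: "s n > 0" if "n \<ge> 1" for n
    using psum_pow_pos[OF that, of p] by (simp add: s_eq)
  have s_le: "s n \<le> real (p + 1) * (w n * c n)" for n
    unfolding w_def s_eq
    by (intro mult_left_mono mono_psum_pow_upper strict_mono_mono strict) auto
  have "concave_seq ((bdiff ^^ p) s)"
    unfolding diff_s concave_seq_def right_diff_distrib[symmetric]
    using decseqD[OF concave[unfolded concave_seq_def]]
    by (intro decseq_SucI mult_left_mono) auto
  moreover have "\<not> bdd_above (range ((bdiff ^^ p) s))"
  proof
    assume "bdd_above (range ((bdiff ^^ p) s))"
    then obtain K where "real (p + 1) * c n \<le> K" for n
      by (auto simp: diff_s bdd_above_def)
    then have "c n \<le> K / real (p + 1)" for n
      by (simp add: field_simps)
    then show False
      using unbounded by (auto simp: bdd_above_def)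
  qed
  moreover have "limsup (\<lambda>n. ereal (b n / s n)) \<le> 1"
  proof (rule Limsup_bounded)
    show "\<forall>\<^sub>F n in sequentially. ereal (b n / s n) \<le> 1"
      using eventually_ge_at_top[of 1]
    proof eventually_elim
      case (elim n)
      then show ?case
        using s_pos s_ge by (simp add: pos_divide_le_eq one_ereal_def)
    qed
  qed
  moreover have "ereal (1 / real (p + 1)) \<le> limsup (\<lambda>n. ereal (b n / s n))"
  proof (rule ccontr)
    assume "\<not> ?thesis"
    then have "limsup (\<lambda>n. ereal (b n / s n)) < ereal (1 / real (p + 1))"
      by simp
    then obtain r where r: "limsup (\<lambda>n. ereal (b n / s n)) < ereal r" "r < 1 / real (p + 1)"
      using ereal_dense2 by force
    then obtain N where N: "\<And>n. n \<ge> N \<Longrightarrow> b n / s n < r"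
      using Limsup_lessD[OF r(1)] by (auto simp: eventually_sequentially)
    \<comment> \<open>Since \<open>s n \<le> (p + 1) * w n * c n\<close>, a ratio
      \<open>b n / s n\<close> below \<open>r\<close> forces \<open>\<beta> n\<close> below
      \<open>\<theta> * c n\<close>. The maximum with 0 covers negative \<open>r\<close>.\<close>
    define \<theta> where "\<theta> = max 0 (r * real (p + 1))"
    have "\<theta> < 1"
      using r(2) by (simp add: \<theta>_def field_simps)
    from c(3)[OF this] obtain n where n: "n \<ge> max 1 N" "\<theta> * c n < \<beta> n"
      by blast
    have "b n < r * s n"
      using N[of n] s_pos[of n] n(1) by (simp add: pos_divide_less_eq)
    also have "\<dots> \<le> max 0 r * s n"
      using s_pos[of n] n(1) by (intro mult_right_mono) auto
    also have "\<dots> \<le> max 0 r * (real (p + 1) * (w n * c n))"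
      by (intro mult_left_mono s_le) auto
    also have "\<dots> = w n * (\<theta> * c n)"
      by (simp add: \<theta>_def max_def mult_le_0_iff zero_le_mult_iff not_le)
    also have "\<dots> \<le> b n"
      unfolding b_eq using n(2) w[of n] by (intro mult_left_mono) auto
    finally show False by simp
  qed
  moreover have "s 0 \<ge> 0"
    by (simp add: s_def zero)
  ultimately show ?thesis
    using s_ge by (intro exI[of _ s]) auto
qed

theorem theorem5p3:
  fixes b :: "nat \<Rightarrow> real"
  assumes "\<not> bdd_above (range b)"
    and "growth_order b < \<infinity>"
  shows "\<exists>p::nat. growth_order b = enat (p + 1) \<and>
    (\<forall>s :: nat \<Rightarrow> real.
        s 0 \<ge> 0 \<and> concave_seq ((bdiff ^^ p) s) \<and> \<not> bdd_above (range ((bdiff ^^ p) s)) \<longrightarrow>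
        (\<forall>n\<ge>1. s n > 0) \<and>
        strict_mono s \<and>
        filterlim (\<lambda>n. s n / real n ^ p) at_top sequentially \<and>
        bounded ((\<lambda>n. s n / real n ^ (p + 1)) ` {1..}) \<and>
        (\<lambda>n. s (n + 1) / s n) \<longlonglongrightarrow> 1 \<and>
        summable (\<lambda>n. \<bar>(bdiff ^^ (p + 2)) s n\<bar>) \<and>
        (p \<ge> 1 \<longrightarrow> convex_seq s)) \<and>
    (\<exists>s :: nat \<Rightarrow> real.
        (\<forall>n. s n \<ge> b n) \<and>
        s 0 \<ge> 0 \<and> concave_seq ((bdiff ^^ p) s) \<and> \<not> bdd_above (range ((bdiff ^^ p) s)) \<and>
        limsup (\<lambda>n. ereal (b n / s n)) \<in> {ereal (1 / real (p + 1))..1})"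
proof -
  obtain p where p: "growth_order b = enat (p + 1)"
    "bdd_above ((\<lambda>n. b n / real n ^ (p + 1)) ` {1..})"
    "\<not> bdd_above ((\<lambda>n. b n / real n ^ p) ` {1..})"
    using growth_order_eq_SucE[OF assms] .
  have props: "(\<forall>n\<ge>1. s n > 0) \<and> strict_mono s \<and>
      filterlim (\<lambda>n. s n / real n ^ p) at_top sequentially \<and>
      bounded ((\<lambda>n. s n / real n ^ (p + 1)) ` {1..}) \<and>
      (\<lambda>n. s (n + 1) / s n) \<longlonglongrightarrow> 1 \<and>
      summable (\<lambda>n. \<bar>(bdiff ^^ (p + 2)) s n\<bar>) \<and>
      (p \<ge> 1 \<longrightarrow> convex_seq s)"
    if "s 0 \<ge> 0 \<and> concave_seq ((bdiff ^^ p) s) \<and> \<not> bdd_above (range ((bdiff ^^ p) s))"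
    for s :: "nat \<Rightarrow> real"
  proof -
    \<comment> \<open>The value at 0 is unchanged by \<open>bdiff\<close>, and
      \<open>psum_pow_bdiff_pow\<close> recovers \<open>s\<close> from its iterated
      difference.\<close>
    interpret unbounded_concave "(bdiff ^^ p) s"
      using that by unfold_locales simp_all
    show ?thesis
      using psum_pow_pos[of _ p] psum_pow_strict[of p] psum_pow_at_top[of p]
        psum_pow_bounded[of p] psum_pow_ratio[of p] psum_pow_convex[of p]
        summable_second_difference
      by simp
  qed
  show ?thesis
    by (rule exI[of _ p], rule conjI[OF p(1) conjI[OF _ majorant_exists[OF p(2,3)]]])
      (intro allI impI props)
qed

end
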